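(* Let $(M,F)$ be a forward complete Finsler manifold and let $\eta,\zeta:[0,\infty)\to M$ be forward rays such that $\zeta$, emanating from $p:=\zeta(0)$, is asymptotic to $\eta$. Then their Busemann functions are related by $$b_{\eta}(\zeta(t)) = b_{\eta}(p)+b_{\zeta}(\zeta(t)) = b_{\eta}(p)-t \quad\text{for all } t\ge 0.$$ Consequently, $$b_{\eta}(x)-b_{\zeta}(x)\le b_{\eta}(p)\quad\text{for all } x\in M.$$
   Context: $M$ is a connected, orientable smooth manifold of dimension $n>1$. A Finsler structure is a function $F:TM\to[0,\infty)$ that is $C^\infty$ on $TM$ minus the zero section, positively homogeneous of degree one in $y$, and such that $g_{ij}(x,y)=\frac12\frac{\partial^2F^2}{\partial y^i\partial y^j}(x,y)$ is positive definite for $y\neq0$. $F$ need not be reversible. The distance is $d_F(p,q)=\inf\int_0^1F(\dot c(t))\,dt$ over $C^1$ curves $c$ from $p$ to $q$; it is in general nonsymmetric. Forward complete means every geodesic $[0,a)\to M$ extends to $[0,\infty)$. A forward ray (ray) is a geodesic $\gamma:[0,\infty)\to M$ with $F(\dot\gamma)=1$ and $d_F(\gamma(s),\gamma(t))=t-s$ for all $s<t$. Its Busemann function is $b_\gamma(x)=\lim_{t\to\infty}\big(d_F(x,\gamma(t))-t\big)$. A ray $\zeta$ is asymptotic to a ray $\eta$ if there are a sequence $t_i\in[0,\infty)$ with $t_i\to\infty$ and unit speed minimal geodesics $\zeta_i:[0,d_F(\zeta(0),\eta(t_i))]\to M$ from $\zeta(0)$ to $\eta(t_i)$ such that $\lim_{i\to\infty}\zeta_i(t)=\zeta(t)$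 for all $t\ge0$. *)

theory Defs
  imports "HOL-Analysis.Analysis"
begin

section \<open>Smooth maps\<close>

fun Ck_on :: "nat \<Rightarrow> 'v::euclidean_space set \<Rightarrow> ('v \<Rightarrow> 'w::real_normed_vector) \<Rightarrow> bool" where
  "Ck_on 0 S f \<longleftrightarrow> continuous_on S f"
| "Ck_on (Suc k) S f \<longleftrightarrow>
     (\<forall>z\<in>S. f differentiable (at z)) \<and> (\<forall>v. Ck_on k S (\<lambda>z. frechet_derivative f (at z) v))"

text \<open>Only used on open sets.\<close>

definition smooth_on :: "'v::euclidean_space set \<Rightarrow> ('v \<Rightarrow> 'w::real_normed_vector) \<Rightarrow> bool" where
  "smooth_on S f \<longleftrightarrow> (\<forall>k. Ck_on k S f)"

section \<open>Smooth manifolds\<close>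

text \<open>The underlying space of the manifold is a whole type, assumed Hausdorff and second countable
  through its type classes.  The dimension is \<open>CARD('n)\<close>.  A chart \<open>(U, f)\<close> consists of its domain
  and its coordinate map; the values of \<open>f\<close> outside \<open>U\<close> are irrelevant.\<close>

type_synonym ('a, 'n) chart = "'a set \<times> ('a \<Rightarrow> real ^ 'n)"

abbreviation chart_dom :: "('a, 'n) chart \<Rightarrow> 'a set" where
  "chart_dom \<phi> \<equiv> fst \<phi>"

abbreviation chart_map :: "('a, 'n) chart \<Rightarrow> 'a \<Rightarrow> real ^ 'n" where
  "chart_map \<phi> \<equiv> snd \<phi>"

definition chart_inv :: "('a, 'n) chart \<Rightarrow> real ^ 'n \<Rightarrow> 'a" where
  "chart_inv \<phi> = inv_into (chart_dom \<phi>) (chart_map \<phi>)"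

definition is_chart :: "('a::topological_space, 'n::finite) chart \<Rightarrow> bool" where
  "is_chart \<phi> \<longleftrightarrow> open (chart_dom \<phi>) \<and> open (chart_map \<phi> ` chart_dom \<phi>) \<and>
     homeomorphism (chart_dom \<phi>) (chart_map \<phi> ` chart_dom \<phi>) (chart_map \<phi>) (chart_inv \<phi>)"

definition transition :: "('a, 'n) chart \<Rightarrow> ('a, 'n) chart \<Rightarrow> real ^ 'n \<Rightarrow> real ^ 'n" where
  "transition \<phi> \<psi> = chart_map \<psi> \<circ> chart_inv \<phi>"

definition transition_deriv ::
    "('a, 'n::finite) chart \<Rightarrow> ('a, 'n) chart \<Rightarrow> 'a \<Rightarrow> real ^ 'n \<Rightarrow> real ^ 'n" where
  "transition_deriv \<phi> \<psi> p = frechet_derivative (transition \<phi> \<psi>) (at (chart_map \<phi> p))"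

definition smooth_atlas :: "('a::topological_space, 'n::finite) chart set \<Rightarrow> bool" where
  "smooth_atlas A \<longleftrightarrow> (\<forall>\<phi>\<in>A. is_chart \<phi>) \<and> (\<Union>\<phi>\<in>A. chart_dom \<phi>) = UNIV \<and>
     (\<forall>\<phi>\<in>A. \<forall>\<psi>\<in>A. smooth_on (chart_map \<phi> ` (chart_dom \<phi> \<inter> chart_dom \<psi>)) (transition \<phi> \<psi>))"

text \<open>The atlas is not required to be maximal, so orientability asks for some oriented atlas of the
  same smooth structure.\<close>

definition orientable :: "('a::topological_space, 'n::finite) chart set \<Rightarrow> bool" where
  "orientable A \<longleftrightarrow> (\<exists>B. smooth_atlas B \<and> smooth_atlas (A \<union> B) \<and>
     (\<forall>\<phi>\<in>B. \<forall>\<psi>\<in>B. \<forall>p \<in> chart_dom \<phi> \<inter> chart_dom \<psi>. det (matrix (transition_deriv \<phi> \<psi> p)) > 0))"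

section \<open>Tangent vectors\<close>

text \<open>A tangent vector at \<open>p\<close> is the family of its coordinate vectors in all the charts around \<open>p\<close>,
  related by the derivatives of the transition maps; it is set to \<open>0\<close> at all other indices.\<close>

type_synonym ('a, 'n) tvec = "('a, 'n) chart \<Rightarrow> real ^ 'n"

definition tangent_space ::
    "('a, 'n::finite) chart set \<Rightarrow> 'a \<Rightarrow> ('a, 'n) tvec set" where
  "tangent_space A p = {v.
     (\<forall>\<phi>. \<not> (\<phi> \<in> A \<and> p \<in> chart_dom \<phi>) \<longrightarrow> v \<phi> = 0) \<and>
     (\<forall>\<phi>\<in>A. \<forall>\<psi>\<in>A. p \<in> chart_dom \<phi> \<inter> chart_dom \<psi> \<longrightarrow> v \<psi> = transition_deriv \<phi> \<psi> p (v \<phi>))}"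

text \<open>The tangent vector at \<open>p\<close> with coordinates \<open>y\<close> in the chart \<open>\<phi>\<close>.\<close>

definition tvec_of ::
    "('a, 'n::finite) chart set \<Rightarrow> ('a, 'n) chart \<Rightarrow> 'a \<Rightarrow> real ^ 'n \<Rightarrow> ('a, 'n) tvec" where
  "tvec_of A \<phi> p y = (\<lambda>\<psi>. if \<psi> \<in> A \<and> p \<in> chart_dom \<psi> then transition_deriv \<phi> \<psi> p y else 0)"

section \<open>Finsler structures\<close>

text \<open>\<open>F p v\<close> is only meaningful for \<open>v\<close> in the tangent space at \<open>p\<close>.  \<open>local_F A F \<phi> (x, y)\<close> is
  \<open>F\<close> in the coordinates \<open>x\<^sup>i, y\<^sup>i\<close> that the chart \<open>\<phi>\<close> induces on the tangent bundle.\<close>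

type_synonym ('a, 'n) tfun = "'a \<Rightarrow> ('a, 'n) tvec \<Rightarrow> real"

definition local_F ::
    "('a, 'n::finite) chart set \<Rightarrow> ('a, 'n) tfun \<Rightarrow> ('a, 'n) chart \<Rightarrow> (real ^ 'n) \<times> (real ^ 'n) \<Rightarrow> real" where
  "local_F A F \<phi> = (\<lambda>(x, y). F (chart_inv \<phi> x) (tvec_of A \<phi> (chart_inv \<phi> x) y))"

definition partial_x ::
    "'n::finite \<Rightarrow> ((real ^ 'n) \<times> (real ^ 'n) \<Rightarrow> real) \<Rightarrow> (real ^ 'n) \<times> (real ^ 'n) \<Rightarrow> real" where
  "partial_x i f z = frechet_derivative f (at z) (axis i 1, 0)"

definition partial_y ::
    "'n::finite \<Rightarrow> ((real ^ 'n) \<times> (real ^ 'n) \<Rightarrow> real) \<Rightarrow> (real ^ 'n) \<times> (real ^ 'n) \<Rightarrow> real" where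
  "partial_y i f z = frechet_derivative f (at z) (0, axis i 1)"

definition fund_tensor ::
    "('a, 'n::finite) chart set \<Rightarrow> ('a, 'n) tfun \<Rightarrow> ('a, 'n) chart \<Rightarrow>
       (real ^ 'n) \<times> (real ^ 'n) \<Rightarrow> real ^ 'n ^ 'n" where
  "fund_tensor A F \<phi> z = (\<chi> i j. 1/2 * partial_y i (partial_y j (\<lambda>u. (local_F A F \<phi> u)\<^sup>2)) z)"

definition finsler_structure ::
    "('a, 'n::finite) chart set \<Rightarrow> ('a, 'n) tfun \<Rightarrow> bool" where
  "finsler_structure A F \<longleftrightarrow>
     (\<forall>p. \<forall>v \<in> tangent_space A p. F p v \<ge> 0) \<and>
     (\<forall>p. \<forall>v \<in> tangent_space A p. \<forall>r>0. F p (\<lambda>\<phi>. r *\<^sub>R v \<phi>) = r * F p v) \<and>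
     (\<forall>\<phi>\<in>A. smooth_on ((chart_map \<phi> ` chart_dom \<phi>) \<times> (- {0})) (local_F A F \<phi>)) \<and>
     (\<forall>\<phi>\<in>A. \<forall>x \<in> chart_map \<phi> ` chart_dom \<phi>. \<forall>y. y \<noteq> 0 \<longrightarrow>
        (\<forall>w. w \<noteq> 0 \<longrightarrow> w \<bullet> (fund_tensor A F \<phi> (x, y) *v w) > 0))"

section \<open>Velocity, length and distance\<close>

text \<open>In the interior of an interval \<open>I\<close> these are ordinary derivatives, at its end points one-sided
  ones.  If \<open>I\<close> is a single point, every tangent vector is a velocity.\<close>

definition has_velocity ::
    "('a::topological_space, 'n::finite) chart set \<Rightarrow> real set \<Rightarrow> (real \<Rightarrow> 'a) \<Rightarrow> real \<Rightarrow>
       ('a, 'n) tvec \<Rightarrow> bool" where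
  "has_velocity A I c t v \<longleftrightarrow>
     continuous (at t within I) c \<and> v \<in> tangent_space A (c t) \<and>
     (\<forall>\<phi>\<in>A. c t \<in> chart_dom \<phi> \<longrightarrow> ((chart_map \<phi> \<circ> c) has_vector_derivative v \<phi>) (at t within I))"

definition velocity ::
    "('a::topological_space, 'n::finite) chart set \<Rightarrow> real set \<Rightarrow> (real \<Rightarrow> 'a) \<Rightarrow> real \<Rightarrow>
       ('a, 'n) tvec" where
  "velocity A I c t = (SOME v. has_velocity A I c t v)"

definition C1_curve ::
    "('a::topological_space, 'n::finite) chart set \<Rightarrow> real set \<Rightarrow> (real \<Rightarrow> 'a) \<Rightarrow> bool" where
  "C1_curve A I c \<longleftrightarrow> (\<exists>V. (\<forall>t\<in>I. has_velocity A I c t (V t)) \<and>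
     (\<forall>\<phi>\<in>A. continuous_on {t \<in> I. c t \<in> chart_dom \<phi>} (\<lambda>t. V t \<phi>)))"

definition curve_length ::
    "('a::topological_space, 'n::finite) chart set \<Rightarrow> ('a, 'n) tfun \<Rightarrow> real \<Rightarrow> real \<Rightarrow>
       (real \<Rightarrow> 'a) \<Rightarrow> real" where
  "curve_length A F a b c = integral {a..b} (\<lambda>t. F (c t) (velocity A {a..b} c t))"

definition finsler_dist ::
    "('a::topological_space, 'n::finite) chart set \<Rightarrow> ('a, 'n) tfun \<Rightarrow> 'a \<Rightarrow> 'a \<Rightarrow> real" where
  "finsler_dist A F p q = Inf {curve_length A F 0 1 c | c. C1_curve A {0..1} c \<and> c 0 = p \<and> c 1 = q}"

section \<open>Geodesics\<close>

text \<open>The spray coefficients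
  \<open>G\<^sup>i = 1/4 g\<^sup>i\<^sup>l (y\<^sup>k \<partial>\<^sup>2F\<^sup>2/\<partial>x\<^sup>k\<partial>y\<^sup>l - \<partial>F\<^sup>2/\<partial>x\<^sup>l)\<close> (summation over \<open>k\<close> and \<open>l\<close>), so that the geodesic
  equation reads \<open>x'' + 2 G(x, x') = 0\<close>.  At \<open>y = 0\<close> the second factor vanishes (whatever the value
  of the second derivatives there), so \<open>G(x, 0) = 0\<close> and constant curves are geodesics.\<close>

definition spray ::
    "('a, 'n::finite) chart set \<Rightarrow> ('a, 'n) tfun \<Rightarrow> ('a, 'n) chart \<Rightarrow>
       real ^ 'n \<Rightarrow> real ^ 'n \<Rightarrow> real ^ 'n" where
  "spray A F \<phi> x y =
     (1/4) *\<^sub>R (matrix_inv (fund_tensor A F \<phi> (x, y)) *v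
       (\<chi> l. (\<Sum>k\<in>UNIV. partial_x k (partial_y l (\<lambda>u. (local_F A F \<phi> u)\<^sup>2)) (x, y) * y $ k)
             - partial_x l (\<lambda>u. (local_F A F \<phi> u)\<^sup>2) (x, y)))"

definition geodesic ::
    "('a::topological_space, 'n::finite) chart set \<Rightarrow> ('a, 'n) tfun \<Rightarrow> real set \<Rightarrow> (real \<Rightarrow> 'a) \<Rightarrow> bool" where
  "geodesic A F I c \<longleftrightarrow> continuous_on I c \<and>
     (\<forall>\<phi>\<in>A. \<exists>x' x''. \<forall>t\<in>I. c t \<in> chart_dom \<phi> \<longrightarrow>
        ((chart_map \<phi> \<circ> c) has_vector_derivative x' t) (at t within I) \<and>
        (x' has_vector_derivative x'' t) (at t within I) \<and>
        x'' t + 2 *\<^sub>R spray A F \<phi> (chart_map \<phi> (c t)) (x' t) = 0)"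

definition unit_speed ::
    "('a::topological_space, 'n::finite) chart set \<Rightarrow> ('a, 'n) tfun \<Rightarrow> real set \<Rightarrow> (real \<Rightarrow> 'a) \<Rightarrow> bool" where
  "unit_speed A F I c \<longleftrightarrow> (\<forall>t\<in>I. \<exists>v. has_velocity A I c t v \<and> F (c t) v = 1)"

definition forward_complete ::
    "('a::topological_space, 'n::finite) chart set \<Rightarrow> ('a, 'n) tfun \<Rightarrow> bool" where
  "forward_complete A F \<longleftrightarrow> (\<forall>a>0. \<forall>c. geodesic A F {0..<a} c \<longrightarrow>
     (\<exists>c'. geodesic A F {0..} c' \<and> (\<forall>t\<in>{0..<a}. c' t = c t)))"

definition unit_speed_minimal_geodesic ::
    "('a::topological_space, 'n::finite) chart set \<Rightarrow> ('a, 'n) tfun \<Rightarrow> 'a \<Rightarrow> 'a \<Rightarrow> (real \<Rightarrow> 'a) \<Rightarrow> bool" where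
  "unit_speed_minimal_geodesic A F p q c \<longleftrightarrow>
     geodesic A F {0..finsler_dist A F p q} c \<and> unit_speed A F {0..finsler_dist A F p q} c \<and>
     c 0 = p \<and> c (finsler_dist A F p q) = q \<and>
     curve_length A F 0 (finsler_dist A F p q) c = finsler_dist A F p q"

section \<open>Rays and Busemann functions\<close>

definition forward_ray ::
    "('a::topological_space, 'n::finite) chart set \<Rightarrow> ('a, 'n) tfun \<Rightarrow> (real \<Rightarrow> 'a) \<Rightarrow> bool" where
  "forward_ray A F \<gamma> \<longleftrightarrow> geodesic A F {0..} \<gamma> \<and> unit_speed A F {0..} \<gamma> \<and>
     (\<forall>s t. 0 \<le> s \<and> s < t \<longrightarrow> finsler_dist A F (\<gamma> s) (\<gamma> t) = t - s)"

definition busemann ::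
    "('a::topological_space, 'n::finite) chart set \<Rightarrow> ('a, 'n) tfun \<Rightarrow> (real \<Rightarrow> 'a) \<Rightarrow> 'a \<Rightarrow> real" where
  "busemann A F \<gamma> x = Lim at_top (\<lambda>t. finsler_dist A F x (\<gamma> t) - t)"

text \<open>The curve \<open>\<sigma> i\<close> is only constrained on \<open>{0..d(\<zeta>(0), \<eta>(T i))}\<close>; these intervals exhaust
  \<open>{0..}\<close>, so the limit below does not see its other values.\<close>

definition asymptotic ::
    "('a::topological_space, 'n::finite) chart set \<Rightarrow> ('a, 'n) tfun \<Rightarrow>
       (real \<Rightarrow> 'a) \<Rightarrow> (real \<Rightarrow> 'a) \<Rightarrow> bool" where
  "asymptotic A F \<zeta> \<eta> \<longleftrightarrow> (\<exists>(T :: nat \<Rightarrow> real) \<sigma>.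
     (\<forall>i. 0 \<le> T i) \<and> filterlim T at_top sequentially \<and>
     (\<forall>i. unit_speed_minimal_geodesic A F (\<zeta> 0) (\<eta> (T i)) (\<sigma> i)) \<and>
     (\<forall>t\<ge>0. (\<lambda>i. \<sigma> i t) \<longlonglongrightarrow> \<zeta> t))"

end

theory Submission
  imports Defs
begin

text \<open>Reparametrising curves so that they stop at their end points makes concatenations \<open>C\<^sup>1\<close>, so
  \<open>d\<^sub>F\<close> satisfies the triangle inequality; since \<open>F\<close> is bounded on unit spheres over compact
  parts of a chart, \<open>d\<^sub>F(x, x\<^sub>i) \<rightarrow> 0\<close> whenever \<open>x\<^sub>i \<rightarrow> x\<close>.  Hence \<open>d\<^sub>F(x, \<gamma>(t)) - t\<close> is nonincreasing and
  bounded below, and \<open>b\<^sub>\<gamma>(x) \<le> d\<^sub>F(x, y) + b\<^sub>\<gamma>(y)\<close>.  For the minimal geodesics \<open>\<zeta>\<^sub>i\<close> approximating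
  \<open>\<zeta>\<close>, \<open>d\<^sub>F(\<zeta>(t), \<eta>(t\<^sub>i)) \<le> d\<^sub>F(\<zeta>(t), \<zeta>\<^sub>i(t)) + d\<^sub>F(p, \<eta>(t\<^sub>i)) - t\<close>, and the limit gives
  \<open>b\<^sub>\<eta>(\<zeta>(t)) \<le> b\<^sub>\<eta>(p) - t\<close>; the converse is \<open>b\<^sub>\<eta>(p) \<le> d\<^sub>F(p, \<zeta>(t)) + b\<^sub>\<eta>(\<zeta>(t))\<close>.  The final inequality
  is the limit of \<open>b\<^sub>\<eta>(x) \<le> d\<^sub>F(x, \<zeta>(t)) + b\<^sub>\<eta>(\<zeta>(t))\<close>.\<close>

section \<open>Calculus within unions of sets\<close>

lemma Ck_on_differentiable: "Ck_on 1 S f \<Longrightarrow> z \<in> S \<Longrightarrow> f differentiable (at z)"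
  by (simp add: numeral_eq_Suc)

text \<open>Needed where two curves meet: equal one-sided derivatives at the junction combine into a
  derivative along the concatenation.\<close>

lemma has_vector_derivative_within_Un:
  assumes "(f has_vector_derivative f') (at x within S)"
    and "(f has_vector_derivative f') (at x within T)"
  shows "(f has_vector_derivative f') (at x within S \<union> T)"
  using assms unfolding has_vector_derivative_def has_derivative_within by (simp add: Lim_within_Un)

lemma continuous_within_Un:
  assumes "continuous (at x within S) f" and "continuous (at x within T) f"
  shows "continuous (at x within S \<union> T) f"
  using assms unfolding continuous_within by (simp add: Lim_within_Un)

locale finsler_manifold =
  fixes A :: "('a::t2_space, 'n::finite) chart set" and F :: "('a, 'n) tfun"
  assumes atlas: "smooth_atlas A" and finsler: "finsler_structure A F"
begin

section \<open>Charts and transition maps\<close>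

lemma chart: "\<phi> \<in> A \<Longrightarrow> is_chart \<phi>"
  using atlas by (simp add: smooth_atlas_def)

lemma chart_at: obtains \<phi> where "\<phi> \<in> A" "p \<in> chart_dom \<phi>"
  using atlas unfolding smooth_atlas_def by (metis UNIV_I UN_E)

lemma open_chart_dom: "\<phi> \<in> A \<Longrightarrow> open (chart_dom \<phi>)"
  using chart is_chart_def by blast

lemma open_chart_image: "\<phi> \<in> A \<Longrightarrow> open (chart_map \<phi> ` chart_dom \<phi>)"
  using chart is_chart_def by blast

lemma chart_homeo:
  "\<phi> \<in> A \<Longrightarrow> homeomorphism (chart_dom \<phi>) (chart_map \<phi> ` chart_dom \<phi>) (chart_map \<phi>) (chart_inv \<phi>)"
  using chart is_chart_def by blast

lemma chart_inv_map [simp]: "\<phi> \<in> A \<Longrightarrow> p \<in> chart_dom \<phi> \<Longrightarrow> chart_inv \<phi> (chart_map \<phi> p) = p"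
  using chart_homeo homeomorphism_apply1 by metis

lemma continuous_chart_map: "\<phi> \<in> A \<Longrightarrow> continuous_on (chart_dom \<phi>) (chart_map \<phi>)"
  using chart_homeo homeomorphism_def by blast

lemma isCont_chart_map: "\<phi> \<in> A \<Longrightarrow> p \<in> chart_dom \<phi> \<Longrightarrow> isCont (chart_map \<phi>) p"
  using continuous_chart_map continuous_on_eq_continuous_at open_chart_dom by blast

lemma isCont_chart_inv:
  "\<phi> \<in> A \<Longrightarrow> x \<in> chart_map \<phi> ` chart_dom \<phi> \<Longrightarrow> isCont (chart_inv \<phi>) x"
  using chart_homeo continuous_on_eq_continuous_at open_chart_image homeomorphism_def by metis

lemma open_chart_image_open:
  assumes "\<phi> \<in> A" and "open U" and "U \<subseteq> chart_dom \<phi>"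
  shows "open (chart_map \<phi> ` U)"
proof -
  have "openin (top_of_set (chart_dom \<phi>)) U"
    using assms open_chart_dom by (simp add: openin_open_eq)
  then show ?thesis
    using homeomorphism_imp_open_map[OF chart_homeo[OF assms(1)]] open_chart_image[OF assms(1)]
      openin_open_trans by blast
qed

lemma transition_smooth:
  "\<phi> \<in> A \<Longrightarrow> \<psi> \<in> A \<Longrightarrow> Ck_on k (chart_map \<phi> ` (chart_dom \<phi> \<inter> chart_dom \<psi>)) (transition \<phi> \<psi>)"
  using atlas by (simp add: smooth_atlas_def smooth_on_def)

lemma transition_has_derivative:
  assumes "\<phi> \<in> A" and "\<psi> \<in> A" and "p \<in> chart_dom \<phi> \<inter> chart_dom \<psi>"
  shows "(transition \<phi> \<psi> has_derivative transition_deriv \<phi> \<psi> p) (at (chart_map \<phi> p))"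
  using Ck_on_differentiable[OF transition_smooth[OF assms(1,2)], of "chart_map \<phi> p"] assms(3)
  unfolding transition_deriv_def by (simp flip: frechet_derivative_works)

lemma linear_transition_deriv:
  assumes "\<phi> \<in> A" and "\<psi> \<in> A" and "p \<in> chart_dom \<phi> \<inter> chart_dom \<psi>"
  shows "linear (transition_deriv \<phi> \<psi> p)"
  using transition_has_derivative[OF assms] by (rule has_derivative_linear)

lemma transition_apply:
  "\<phi> \<in> A \<Longrightarrow> p \<in> chart_dom \<phi> \<Longrightarrow> transition \<phi> \<psi> (chart_map \<phi> p) = chart_map \<psi> p"
  by (simp add: transition_def)

text \<open>The cocycle identity. On the image of the triple overlap, which is open, the composite
  of two transitions agrees with the third, so the chain rule and uniqueness of derivatives
  apply.\<close>

lemma transition_deriv_compose: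
  assumes A: "\<phi> \<in> A" "\<psi> \<in> A" "\<theta> \<in> A" and p: "p \<in> chart_dom \<phi> \<inter> chart_dom \<psi> \<inter> chart_dom \<theta>"
  shows "transition_deriv \<psi> \<theta> p (transition_deriv \<phi> \<psi> p y) = transition_deriv \<phi> \<theta> p y"
proof -
  let ?U = "chart_dom \<phi> \<inter> chart_dom \<psi> \<inter> chart_dom \<theta>"
  have "((transition \<psi> \<theta> \<circ> transition \<phi> \<psi>) has_derivative
      transition_deriv \<psi> \<theta> p \<circ> transition_deriv \<phi> \<psi> p) (at (chart_map \<phi> p))"
    using transition_has_derivative[of \<phi> \<psi> p] transition_has_derivative[of \<psi> \<theta> p] A p
    by (intro diff_chain_at) (auto simp: transition_apply)
  then have "(transition \<phi> \<theta> has_derivative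
      transition_deriv \<psi> \<theta> p \<circ> transition_deriv \<phi> \<psi> p) (at (chart_map \<phi> p))"
  proof (rule has_derivative_transform_within_open)
    show "open (chart_map \<phi> ` ?U)"
      using A by (intro open_chart_image_open) (auto intro!: open_chart_dom)
  qed (use A p in \<open>auto simp: transition_apply\<close>)
  moreover have "(transition \<phi> \<theta> has_derivative transition_deriv \<phi> \<theta> p) (at (chart_map \<phi> p))"
    using A p by (intro transition_has_derivative) auto
  ultimately have "transition_deriv \<psi> \<theta> p \<circ> transition_deriv \<phi> \<psi> p = transition_deriv \<phi> \<theta> p"
    by (rule has_derivative_unique)
  then show ?thesis by (simp add: fun_eq_iff)
qed

section \<open>Tangent vectors as compatible families of coordinates\<close>

lemma tangent_spaceI:
  assumes "\<And>\<phi>. \<phi> \<notin> A \<or> p \<notin> chart_dom \<phi> \<Longrightarrow> v \<phi> = 0"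
    and "\<And>\<phi> \<psi>. \<phi> \<in> A \<Longrightarrow> \<psi> \<in> A \<Longrightarrow> p \<in> chart_dom \<phi> \<inter> chart_dom \<psi> \<Longrightarrow>
      transition_deriv \<phi> \<psi> p (v \<phi>) = v \<psi>"
  shows "v \<in> tangent_space A p"
  unfolding tangent_space_def using assms by simp

lemma tangent_space_outside: "v \<in> tangent_space A p \<Longrightarrow> \<phi> \<notin> A \<or> p \<notin> chart_dom \<phi> \<Longrightarrow> v \<phi> = 0"
  unfolding tangent_space_def by blast

lemma tangent_space_transition:
  "v \<in> tangent_space A p \<Longrightarrow> \<phi> \<in> A \<Longrightarrow> \<psi> \<in> A \<Longrightarrow> p \<in> chart_dom \<phi> \<inter> chart_dom \<psi> \<Longrightarrow>
    transition_deriv \<phi> \<psi> p (v \<phi>) = v \<psi>"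
  unfolding tangent_space_def mem_Collect_eq by metis

lemma tangent_space_scaleR:
  assumes "v \<in> tangent_space A p" shows "(\<lambda>\<phi>. r *\<^sub>R v \<phi>) \<in> tangent_space A p"
proof (rule tangent_spaceI)
  fix \<phi> \<psi> assume *: "\<phi> \<in> A" "\<psi> \<in> A" "p \<in> chart_dom \<phi> \<inter> chart_dom \<psi>"
  show "transition_deriv \<phi> \<psi> p (r *\<^sub>R v \<phi>) = r *\<^sub>R v \<psi>"
    using linear_scale[OF linear_transition_deriv[OF *]] tangent_space_transition[OF assms *] by simp
qed (use tangent_space_outside[OF assms] in simp)

lemma tangent_space_zero: "(\<lambda>\<phi>. 0) \<in> tangent_space A p"
  by (rule tangent_spaceI) (auto intro!: linear_0 linear_transition_deriv)

text \<open>Compatibility between the charts is exactly the cocycle identity.\<close>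

lemma tvec_of_in:
  assumes "\<phi> \<in> A" "p \<in> chart_dom \<phi>" shows "tvec_of A \<phi> p y \<in> tangent_space A p"
  using assms by (intro tangent_spaceI) (auto simp: tvec_of_def intro!: transition_deriv_compose)

text \<open>The coordinates in one chart determine the whole family: transitions give the entries at
  charts around \<open>p\<close>, and the default \<open>0\<close> gives the others.\<close>

lemma tvec_of_eq:
  assumes "v \<in> tangent_space A p" "\<phi> \<in> A" "p \<in> chart_dom \<phi>" shows "tvec_of A \<phi> p (v \<phi>) = v"
proof
  fix \<psi>
  show "tvec_of A \<phi> p (v \<phi>) \<psi> = v \<psi>"
  proof (cases "\<psi> \<in> A \<and> p \<in> chart_dom \<psi>")
    case True
    then have "transition_deriv \<phi> \<psi> p (v \<phi>) = v \<psi>"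
      using assms by (intro tangent_space_transition) auto
    then show ?thesis using True by (simp only: tvec_of_def) simp
  next
    case False
    then have "v \<psi> = 0" using tangent_space_outside[OF assms(1)] by blast
    with False show ?thesis by (auto simp: tvec_of_def)
  qed
qed

section \<open>The Finsler function in coordinates\<close>

lemma F_nonneg: "v \<in> tangent_space A p \<Longrightarrow> F p v \<ge> 0"
  using finsler unfolding finsler_structure_def by blast

lemma F_scaleR_pos: "v \<in> tangent_space A p \<Longrightarrow> r > 0 \<Longrightarrow> F p (\<lambda>\<phi>. r *\<^sub>R v \<phi>) = r * F p v"
  using finsler unfolding finsler_structure_def by blast

text \<open>Homogeneity is assumed for positive factors only; doubling the zero vector gives
  \<open>F 0 = 2 * F 0\<close>.\<close>

lemma F_zero: "F p (\<lambda>\<phi>. 0) = 0"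
  using F_scaleR_pos[OF tangent_space_zero, of 2 p] by simp

lemma F_scaleR:
  "v \<in> tangent_space A p \<Longrightarrow> r \<ge> 0 \<Longrightarrow> F p (\<lambda>\<phi>. r *\<^sub>R v \<phi>) = r * F p v"
  by (cases "r = 0") (simp_all add: F_zero F_scaleR_pos)

lemma local_F_eq:
  "v \<in> tangent_space A p \<Longrightarrow> \<phi> \<in> A \<Longrightarrow> p \<in> chart_dom \<phi> \<Longrightarrow> local_F A F \<phi> (chart_map \<phi> p, v \<phi>) = F p v"
  by (simp add: local_F_def tvec_of_eq)

lemma local_F_scaleR:
  assumes "\<phi> \<in> A" "x \<in> chart_map \<phi> ` chart_dom \<phi>" "r \<ge> 0"
  shows "local_F A F \<phi> (x, r *\<^sub>R y) = r * local_F A F \<phi> (x, y)"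
proof -
  let ?p = "chart_inv \<phi> x"
  have p: "?p \<in> chart_dom \<phi>" using assms by auto
  have "tvec_of A \<phi> ?p (r *\<^sub>R y) = (\<lambda>\<psi>. r *\<^sub>R tvec_of A \<phi> ?p y \<psi>)"
    using p assms(1) by (auto simp: tvec_of_def linear_transition_deriv linear_scale)
  then show ?thesis
    using F_scaleR[OF tvec_of_in[OF assms(1) p] assms(3)] by (simp add: local_F_def)
qed

lemma local_F_zero:
  assumes "\<phi> \<in> A" "x \<in> chart_map \<phi> ` chart_dom \<phi>"
  shows "local_F A F \<phi> (x, 0) = 0"
  using local_F_scaleR[OF assms, of 0] by simp

lemma local_F_nonneg:
  assumes "\<phi> \<in> A" "x \<in> chart_map \<phi> ` chart_dom \<phi>"
  shows "local_F A F \<phi> (x, y) \<ge> 0"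
  using assms by (auto simp: local_F_def intro!: F_nonneg tvec_of_in)

lemma local_F_continuous_nonzero:
  "\<phi> \<in> A \<Longrightarrow> continuous_on ((chart_map \<phi> ` chart_dom \<phi>) \<times> (- {0})) (local_F A F \<phi>)"
  using finsler Ck_on.simps(1) unfolding finsler_structure_def smooth_on_def by blast

text \<open>On a closed ball times the unit sphere \<open>local_F\<close> is continuous, hence
  bounded by compactness; homogeneity extends the bound to all \<open>y\<close>. The sphere avoids
  the zero section, where no smoothness is available.\<close>

lemma local_F_bound:
  assumes \<phi>: "\<phi> \<in> A" and x0: "x0 \<in> chart_map \<phi> ` chart_dom \<phi>"
  obtains e C where "e > 0" "C \<ge> 0" "cball x0 e \<subseteq> chart_map \<phi> ` chart_dom \<phi>"
    "\<And>x y. x \<in> cball x0 e \<Longrightarrow> local_F A F \<phi> (x, y) \<le> C * norm y"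
proof -
  obtain e where e: "e > 0" "cball x0 e \<subseteq> chart_map \<phi> ` chart_dom \<phi>"
    using open_contains_cball open_chart_image[OF \<phi>] x0 by blast
  let ?K = "cball x0 e \<times> sphere (0::real^'n) 1"
  have "continuous_on ?K (local_F A F \<phi>)"
    using e by (intro continuous_on_subset[OF local_F_continuous_nonzero[OF \<phi>]]) auto
  then have "bounded (local_F A F \<phi> ` ?K)"
    by (intro compact_imp_bounded compact_continuous_image compact_Times) auto
  then obtain C where C: "C > 0" "\<And>z. z \<in> ?K \<Longrightarrow> norm (local_F A F \<phi> z) \<le> C"
    unfolding bounded_pos by blast
  show ?thesis
  proof
    fix x y assume x: "x \<in> cball x0 e"
    then have xU: "x \<in> chart_map \<phi> ` chart_dom \<phi>" using e by blast
    show "local_F A F \<phi> (x, y) \<le> C * norm y"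
    proof (cases "y = 0")
      case False
      have "local_F A F \<phi> (x, y) = local_F A F \<phi> (x, norm y *\<^sub>R ((1 / norm y) *\<^sub>R y))"
        using False by simp
      also have "\<dots> = norm y * local_F A F \<phi> (x, (1 / norm y) *\<^sub>R y)"
        by (rule local_F_scaleR[OF \<phi> xU]) simp
      also have "\<dots> \<le> norm y * C"
        using C(2)[of "(x, (1 / norm y) *\<^sub>R y)"] x False by (intro mult_left_mono) auto
      finally show ?thesis by (simp add: mult.commute)
    qed (simp add: local_F_zero[OF \<phi> xU])
  qed (use e C in auto)
qed

text \<open>Off the zero section this is part of smoothness. At \<open>y0 = 0\<close> the values are
  squeezed between \<open>0\<close> and \<open>C * norm y\<close>. Continuity there is required
  because reparametrised curves may have velocity zero.\<close>

lemma isCont_local_F: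
  assumes \<phi>: "\<phi> \<in> A" and x0: "x0 \<in> chart_map \<phi> ` chart_dom \<phi>"
  shows "isCont (local_F A F \<phi>) (x0, y0)"
proof (cases "y0 = 0")
  case False
  have "open ((chart_map \<phi> ` chart_dom \<phi>) \<times> (- {0::real^'n}))"
    by (intro open_Times open_chart_image[OF \<phi>] open_Compl closed_singleton)
  then show ?thesis
    using local_F_continuous_nonzero[OF \<phi>] x0 False
    by (metis ComplI SigmaI continuous_on_eq_continuous_at singletonD)
next
  case True
  obtain e C where e: "e > 0" "C \<ge> 0" "cball x0 e \<subseteq> chart_map \<phi> ` chart_dom \<phi>"
    "\<And>x y. x \<in> cball x0 e \<Longrightarrow> local_F A F \<phi> (x, y) \<le> C * norm y"
    using local_F_bound[OF \<phi> x0] by blast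
  have "\<forall>\<^sub>F z in nhds (x0, 0::real^'n). z \<in> ball x0 e \<times> UNIV"
    using e(1) by (intro eventually_nhds_in_open open_Times) auto
  then have ev: "\<forall>\<^sub>F z in at (x0, 0::real^'n). fst z \<in> cball x0 e"
    unfolding eventually_at_filter by eventually_elim auto
  have "((\<lambda>z. local_F A F \<phi> z) \<longlongrightarrow> 0) (at (x0, 0))"
  proof (rule tendsto_sandwich)
    show "\<forall>\<^sub>F z in at (x0, 0). 0 \<le> local_F A F \<phi> z"
      using ev by eventually_elim (use e(3) in \<open>auto intro!: local_F_nonneg[OF \<phi>]\<close>)
    show "\<forall>\<^sub>F z in at (x0, 0). local_F A F \<phi> z \<le> C * norm (snd z)"
      using ev by eventually_elim (auto intro!: e(4))
    show "((\<lambda>z. C * norm (snd z)) \<longlongrightarrow> 0) (at (x0, 0::real^'n))"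
      by (auto intro!: tendsto_eq_intros)
  qed simp
  then show ?thesis using True local_F_zero[OF \<phi> x0] by (simp add: isCont_def)
qed

section \<open>Velocities of curves\<close>

text \<open>The filter must be nontrivial, since at an isolated point of \<open>I\<close> every
  tangent vector is a velocity. At indices outside the charts around \<open>c t\<close> both
  families are \<open>0\<close> by convention.\<close>

lemma has_velocity_unique:
  assumes "has_velocity A I c t v" "has_velocity A I c t w" "at t within I \<noteq> bot"
  shows "v = w"
proof
  fix \<phi>
  show "v \<phi> = w \<phi>"
  proof (cases "\<phi> \<in> A \<and> c t \<in> chart_dom \<phi>")
    case True
    then show ?thesis
      using assms vector_derivative_unique_within unfolding has_velocity_def by blast
  next
    case False
    then have "v \<phi> = 0" "w \<phi> = 0"
      using assms tangent_space_outside unfolding has_velocity_def by blast+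
    then show ?thesis by simp
  qed
qed

lemma velocity_eq:
  assumes "has_velocity A I c t v" "at t within I \<noteq> bot"
  shows "velocity A I c t = v"
  unfolding velocity_def using assms by (intro some_equality) (auto intro: has_velocity_unique)

lemma has_velocity_subset: "has_velocity A I c t v \<Longrightarrow> J \<subseteq> I \<Longrightarrow> has_velocity A J c t v"
  unfolding has_velocity_def
  using continuous_within_subset has_vector_derivative_within_subset by blast

lemma has_velocity_Un:
  "has_velocity A I c t v \<Longrightarrow> has_velocity A J c t v \<Longrightarrow> has_velocity A (I \<union> J) c t v"
  unfolding has_velocity_def
  using continuous_within_Un has_vector_derivative_within_Un by blast

lemma has_velocity_cong:
  assumes v: "has_velocity A I c t v" and t: "t \<in> I" and eq: "\<And>s. s \<in> I \<Longrightarrow> c' s = c s"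
  shows "has_velocity A I c' t v"
  unfolding has_velocity_def
proof (intro conjI ballI impI)
  show "continuous (at t within I) c'"
    using v t eq unfolding has_velocity_def
    by (metis continuous_transform_within zero_less_one)
  show "v \<in> tangent_space A (c' t)"
    using v t eq unfolding has_velocity_def by simp
next
  fix \<phi> assume "\<phi> \<in> A" "c' t \<in> chart_dom \<phi>"
  then have "((chart_map \<phi> \<circ> c) has_vector_derivative v \<phi>) (at t within I)"
    using v t eq unfolding has_velocity_def by simp
  then show "((chart_map \<phi> \<circ> c') has_vector_derivative v \<phi>) (at t within I)"
    by (rule has_vector_derivative_transform[OF t, rotated]) (simp add: eq)
qed

text \<open>The chain rule in every chart. The factor \<open>r\<close> may be \<open>0\<close>,
  which is what allows a curve to be slowed down to rest.\<close>

lemma has_velocity_compose: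
  assumes v: "has_velocity A I c (h s) v" and h: "(h has_field_derivative r) (at s within J)"
    and sub: "h ` J \<subseteq> I"
  shows "has_velocity A J (c \<circ> h) s (\<lambda>\<phi>. r *\<^sub>R v \<phi>)"
  unfolding has_velocity_def
proof (intro conjI ballI impI)
  show "continuous (at s within J) (c \<circ> h)"
    using v continuous_within_subset[OF _ sub] DERIV_continuous[OF h]
    unfolding has_velocity_def by (intro continuous_within_compose) auto
  show "(\<lambda>\<phi>. r *\<^sub>R v \<phi>) \<in> tangent_space A ((c \<circ> h) s)"
    using v tangent_space_scaleR unfolding has_velocity_def by simp
next
  fix \<phi> assume "\<phi> \<in> A" "(c \<circ> h) s \<in> chart_dom \<phi>"
  then have "((chart_map \<phi> \<circ> c) has_vector_derivative v \<phi>) (at (h s) within h ` J)"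
    using v unfolding has_velocity_def by (auto intro: has_vector_derivative_within_subset[OF _ sub])
  then show "((chart_map \<phi> \<circ> (c \<circ> h)) has_vector_derivative r *\<^sub>R v \<phi>) (at s within J)"
    using vector_diff_chain_within[of h r s J "chart_map \<phi> \<circ> c"] h
    by (simp add: has_real_derivative_iff_has_vector_derivative o_assoc)
qed

section \<open>Curves with an explicit velocity field\<close>

text \<open>Exposes the witness hidden in \<open>C1_curve\<close>, so that reparametrisation and
  gluing act on a concrete field instead of the choice made by \<open>velocity\<close>.\<close>

definition C1_with :: "real set \<Rightarrow> (real \<Rightarrow> 'a) \<Rightarrow> (real \<Rightarrow> ('a, 'n) tvec) \<Rightarrow> bool" where
  "C1_with I c V \<longleftrightarrow> (\<forall>t\<in>I. has_velocity A I c t (V t)) \<and>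
     (\<forall>\<phi>\<in>A. continuous_on {t \<in> I. c t \<in> chart_dom \<phi>} (\<lambda>t. V t \<phi>))"

lemma C1_curve_iff: "C1_curve A I c \<longleftrightarrow> (\<exists>V. C1_with I c V)"
  unfolding C1_curve_def C1_with_def ..

lemma C1_with_velocity: "C1_with I c V \<Longrightarrow> t \<in> I \<Longrightarrow> has_velocity A I c t (V t)"
  unfolding C1_with_def by blast

lemma C1_with_tangent: "C1_with I c V \<Longrightarrow> t \<in> I \<Longrightarrow> V t \<in> tangent_space A (c t)"
  using C1_with_velocity has_velocity_def by blast

lemma C1_with_continuous: "C1_with I c V \<Longrightarrow> continuous_on I c"
  using C1_with_velocity unfolding continuous_on_eq_continuous_within has_velocity_def by blast

lemma C1_with_continuous_velocity:
  "C1_with I c V \<Longrightarrow> \<phi> \<in> A \<Longrightarrow> continuous_on {t \<in> I. c t \<in> chart_dom \<phi>} (\<lambda>t. V t \<phi>)"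
  unfolding C1_with_def by blast

lemma C1_with_subset:
  assumes "C1_with I c V" "J \<subseteq> I" shows "C1_with J c V"
  unfolding C1_with_def
proof (intro conjI ballI)
  fix \<phi> assume "\<phi> \<in> A"
  then show "continuous_on {t \<in> J. c t \<in> chart_dom \<phi>} (\<lambda>t. V t \<phi>)"
    using assms(2) by (intro continuous_on_subset[OF C1_with_continuous_velocity[OF assms(1)]]) auto
qed (use assms C1_with_velocity has_velocity_subset in blast)

text \<open>Continuity is local: near \<open>t\<close> the curve stays in one chart, where the speed
  is \<open>local_F\<close> of position and velocity coordinates.\<close>

lemma C1_with_continuous_speed:
  assumes C1: "C1_with I c V"
  shows "continuous_on I (\<lambda>t. F (c t) (V t))"
  unfolding continuous_on_eq_continuous_within
proof
  fix t assume t: "t \<in> I"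
  obtain \<phi> where \<phi>: "\<phi> \<in> A" "c t \<in> chart_dom \<phi>" by (rule chart_at)
  let ?J = "{s \<in> I. c s \<in> chart_dom \<phi>}"
  let ?f = "\<lambda>s. local_F A F \<phi> (chart_map \<phi> (c s), V s \<phi>)"
  have "continuous (at t within ?J) c"
    using C1_with_continuous[OF C1] t continuous_on_eq_continuous_within continuous_within_subset
    by (metis (no_types, lifting) mem_Collect_eq subsetI)
  then have "continuous (at t within ?J) (\<lambda>s. chart_map \<phi> (c s))"
    by (rule continuous_within_compose3[where f = c, OF isCont_chart_map[OF \<phi>]])
  moreover have "continuous (at t within ?J) (\<lambda>s. V s \<phi>)"
    using C1_with_continuous_velocity[OF C1 \<phi>(1)] t \<phi> by (simp add: continuous_on_eq_continuous_within)
  ultimately have "continuous (at t within ?J) (\<lambda>s. (chart_map \<phi> (c s), V s \<phi>))"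
    by (rule continuous_Pair)
  then have "continuous (at t within ?J) ?f"
    using continuous_within_compose3[where g = "local_F A F \<phi>" and f = "\<lambda>s. (chart_map \<phi> (c s), V s \<phi>)"]
      isCont_local_F[OF \<phi>(1) imageI[OF \<phi>(2)]] by blast
  then have "continuous (at t within ?J) (\<lambda>s. F (c s) (V s))"
  proof (rule continuous_transform_within[OF _ zero_less_one])
    fix s assume "s \<in> ?J"
    then show "?f s = F (c s) (V s)"
      using \<phi>(1) C1_with_tangent[OF C1] by (intro local_F_eq) auto
  qed (use t \<phi> in auto)
  \<comment> \<open>The times spent in the chart are relatively open in \<open>I\<close>, so limits
    at \<open>t\<close> along \<open>?J\<close> and along \<open>I\<close> coincide.\<close>
  moreover obtain U where "open U" "U \<inter> I = c -` chart_dom \<phi> \<inter> I"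
    using C1_with_continuous[OF C1] open_chart_dom[OF \<phi>(1)] unfolding continuous_on_open_invariant
    by blast
  then have "at t within ?J = at t within I"
    using t \<phi>(2) by (intro at_within_nhd[of _ U]) auto
  ultimately show "continuous (at t within I) (\<lambda>s. F (c s) (V s))" by simp
qed

lemma at_within_interval_neq_bot: "a < b \<Longrightarrow> t \<in> {a..b} \<Longrightarrow> at t within {a..b::real} \<noteq> bot"
  by (simp add: trivial_limit_within islimpt_Icc)

text \<open>With \<open>a < b\<close> no time is isolated, so \<open>velocity\<close> must choose
  \<open>V\<close>.\<close>

lemma curve_length_eq:
  assumes "C1_with {a..b} c V" "a < b"
  shows "curve_length A F a b c = integral {a..b} (\<lambda>t. F (c t) (V t))"
  unfolding curve_length_def
  using assms C1_with_velocity velocity_eq at_within_interval_neq_bot by (intro integral_cong) metis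

lemma C1_with_has_integral:
  "C1_with {a..b} c V \<Longrightarrow> ((\<lambda>t. F (c t) (V t)) has_integral integral {a..b} (\<lambda>t. F (c t) (V t))) {a..b}"
  by (intro integrable_integral integrable_continuous_real C1_with_continuous_speed)

text \<open>Integration by substitution. The sign of \<open>h'\<close> enters twice: it makes
  \<open>h\<close> monotone, hence keeps it inside \<open>{a..b}\<close>, and it lets
  \<open>h'\<close> be pulled out of \<open>F\<close>, which is homogeneous only for nonnegative
  factors.\<close>

lemma C1_with_reparam:
  assumes C1: "C1_with {a..b} c V" and le: "a' \<le> b'" and h: "h a' = a" "h b' = b"
    and deriv: "\<And>s. s \<in> {a'..b'} \<Longrightarrow> (h has_field_derivative h' s) (at s within {a'..b'})"
    and cont: "continuous_on {a'..b'} h'" and nonneg: "\<And>s. s \<in> {a'..b'} \<Longrightarrow> h' s \<ge> 0"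
  defines "W \<equiv> \<lambda>s \<phi>. h' s *\<^sub>R V (h s) \<phi>"
  shows "C1_with {a'..b'} (c \<circ> h) W"
    and "integral {a'..b'} (\<lambda>s. F ((c \<circ> h) s) (W s)) = integral {a..b} (\<lambda>t. F (c t) (V t))"
proof -
  have mono: "h x \<le> h y" if "a' \<le> x" "x \<le> y" "y \<le> b'" for x y
  proof (rule DERIV_nonneg_imp_increasing_open[OF that(2)])
    show "\<exists>z. DERIV h s :> z \<and> 0 \<le> z" if "x < s" "s < y" for s
      using deriv[of s] nonneg[of s] that \<open>a' \<le> x\<close> \<open>y \<le> b'\<close>
      by (metis at_within_Icc_at atLeastAtMost_iff less_eq_real_def order_le_less_trans order_less_le_trans)
    show "continuous_on {x..y} h"
      using DERIV_continuous_on[OF deriv] that continuous_on_subset by force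
  qed
  have sub: "h ` {a'..b'} \<subseteq> {a..b}" using mono h by force
  have conth: "continuous_on {a'..b'} h" using deriv by (rule DERIV_continuous_on)
  show "C1_with {a'..b'} (c \<circ> h) W"
    unfolding C1_with_def
  proof (intro conjI ballI)
    fix s assume s: "s \<in> {a'..b'}"
    show "has_velocity A {a'..b'} (c \<circ> h) s (W s)"
      unfolding W_def using C1_with_velocity[OF C1, of "h s"] s sub deriv
      by (intro has_velocity_compose) blast+
  next
    fix \<phi> assume \<phi>: "\<phi> \<in> A"
    show "continuous_on {t \<in> {a'..b'}. (c \<circ> h) t \<in> chart_dom \<phi>} (\<lambda>t. W t \<phi>)"
      unfolding W_def using sub[unfolded image_subset_iff]
      by (intro continuous_on_scaleR continuous_on_subset[OF cont]
          continuous_on_compose2[OF C1_with_continuous_velocity[OF C1 \<phi>]] continuous_on_subset[OF conth]) auto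
  qed
  have ab: "a \<le> b" using mono[of a' b'] le h by simp
  have "((\<lambda>s. h' s *\<^sub>R F (c (h s)) (V (h s))) has_integral (integral {h a'..h b'} (\<lambda>t. F (c t) (V t)))) {a'..b'}"
    by (rule has_integral_substitution[OF le _ sub C1_with_continuous_speed[OF C1] deriv])
      (use ab h in auto)
  moreover have "F ((c \<circ> h) s) (W s) = h' s *\<^sub>R F (c (h s)) (V (h s))" if "s \<in> {a'..b'}" for s
    unfolding W_def using that nonneg sub[unfolded image_subset_iff] C1_with_tangent[OF C1, of "h s"]
    by (simp add: F_scaleR)
  ultimately have "((\<lambda>s. F ((c \<circ> h) s) (W s)) has_integral (integral {h a'..h b'} (\<lambda>t. F (c t) (V t)))) {a'..b'}"
    by (subst has_integral_cong) auto
  then show "integral {a'..b'} (\<lambda>s. F ((c \<circ> h) s) (W s)) = integral {a..b} (\<lambda>t. F (c t) (V t))"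
    using h by (simp add: integral_unique)
qed

lemma C1_with_cong:
  assumes C1: "C1_with I c V" and eq: "\<And>t. t \<in> I \<Longrightarrow> c' t = c t" "\<And>t. t \<in> I \<Longrightarrow> V' t = V t"
  shows "C1_with I c' V'"
  unfolding C1_with_def
proof (intro conjI ballI)
  fix t assume "t \<in> I"
  then show "has_velocity A I c' t (V' t)"
    using has_velocity_cong[OF C1_with_velocity[OF C1]] eq by metis
next
  fix \<phi> assume "\<phi> \<in> A"
  moreover have "{t \<in> I. c' t \<in> chart_dom \<phi>} = {t \<in> I. c t \<in> chart_dom \<phi>}" using eq by auto
  ultimately show "continuous_on {t \<in> I. c' t \<in> chart_dom \<phi>} (\<lambda>t. V' t \<phi>)"
    using continuous_on_eq[OF C1_with_continuous_velocity[OF C1]] eq by simp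
qed

text \<open>At a common point the two one-sided conditions combine because the same \<open>V\<close>
  serves both sides. At a point of only one set the other condition is vacuous, as closedness makes
  the filter trivial.\<close>

lemma C1_with_Un:
  assumes I: "C1_with I c V" "closed I" and J: "C1_with J c V" "closed J"
  shows "C1_with (I \<union> J) c V"
  unfolding C1_with_def
proof (intro conjI ballI)
  have *: "has_velocity A I c t v" if "closed I" "t \<notin> I" "v \<in> tangent_space A (c t)" for I t v
  proof -
    have "at t within I = bot" using that closed_limpt trivial_limit_within by blast
    then show ?thesis
      using that unfolding has_velocity_def has_vector_derivative_def has_derivative_def
      by (simp add: bounded_linear_scaleR_left)
  qed
  fix t assume "t \<in> I \<union> J"
  then show "has_velocity A (I \<union> J) c t (V t)"
    using *[of I] *[of J] I J C1_with_velocity C1_with_tangent has_velocity_Un by (metis UnE)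
next
  fix \<phi> assume \<phi>: "\<phi> \<in> A"
  let ?D = "\<lambda>I. {t \<in> I. c t \<in> chart_dom \<phi>}"
  \<comment> \<open>The set \<open>?D I\<close> need not be closed, but a point outside the closed
    set \<open>I\<close> is not a limit point of any subset of it.\<close>
  have *: "continuous (at t within ?D I) (\<lambda>t. V t \<phi>)" if "closed I" "C1_with I c V" "c t \<in> chart_dom \<phi>" for t I
  proof (cases "t \<in> I")
    case True
    then show ?thesis
      using C1_with_continuous_velocity[OF that(2) \<phi>] that(3) by (simp add: continuous_on_eq_continuous_within)
  next
    case False
    have "at t within ?D I = bot"
      using False that(1) islimpt_subset[of t "?D I" I] closed_limpt trivial_limit_within by blast
    then show ?thesis by simp
  qed
  have "?D (I \<union> J) = ?D I \<union> ?D J" by blast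
  then show "continuous_on (?D (I \<union> J)) (\<lambda>t. V t \<phi>)"
    using *[OF I(2,1)] *[OF J(2,1)] unfolding continuous_on_eq_continuous_within
    by (auto intro!: continuous_within_Un)
qed

section \<open>Lengths of joining curves\<close>

text \<open>Keeps end points and length and forgets the curve, so that concatenation becomes
  addition of lengths.\<close>

definition joins :: "'a \<Rightarrow> 'a \<Rightarrow> real \<Rightarrow> bool" where
  "joins x y l \<longleftrightarrow> (\<exists>c V. C1_with {0..1} c V \<and> c 0 = x \<and> c 1 = y \<and>
     l = integral {0..1} (\<lambda>t. F (c t) (V t)))"

lemma finsler_dist_eq: "finsler_dist A F x y = Inf {l. joins x y l}"
proof -
  have "{curve_length A F 0 1 c | c. C1_curve A {0..1} c \<and> c 0 = x \<and> c 1 = y} = {l. joins x y l}"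
    (is "?L = ?R")
  proof (intro equalityI subsetI)
    fix l assume "l \<in> ?L"
    then obtain c V where "C1_with {0..1} c V" "c 0 = x" "c 1 = y" "l = curve_length A F 0 1 c"
      unfolding C1_curve_iff by blast
    then show "l \<in> ?R" unfolding joins_def using curve_length_eq[of 0 1 c V] by auto
  next
    fix l assume "l \<in> ?R"
    then obtain c V where "C1_with {0..1} c V" "c 0 = x" "c 1 = y"
      "l = integral {0..1} (\<lambda>t. F (c t) (V t))"
      unfolding joins_def by blast
    moreover from this have "l = curve_length A F 0 1 c" using curve_length_eq[of 0 1 c V] by simp
    ultimately show "l \<in> ?L" using C1_curve_iff by blast
  qed
  then show ?thesis unfolding finsler_dist_def by simp
qed

lemma joins_nonneg:
  assumes "joins x y l" shows "0 \<le> l"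
proof -
  obtain c V where c: "C1_with {0..1} c V" and l: "l = integral {0..1} (\<lambda>t. F (c t) (V t))"
    using assms unfolding joins_def by blast
  show ?thesis unfolding l
    by (rule has_integral_nonneg[OF C1_with_has_integral[OF c]]) (rule F_nonneg[OF C1_with_tangent[OF c]])
qed

text \<open>The affine map from \<open>{0..1}\<close> onto \<open>{a..b}\<close> preserves
  length.\<close>

lemma joinsI:
  assumes C1: "C1_with {a..b} c V" and ab: "a < b"
  shows "joins (c a) (c b) (integral {a..b} (\<lambda>t. F (c t) (V t)))"
proof -
  let ?h = "\<lambda>s. a + s * (b - a)" and ?W = "\<lambda>s \<phi>. (b - a) *\<^sub>R V (a + s * (b - a)) \<phi>"
  have "C1_with {0..1} (c \<circ> ?h) ?W"
    and "integral {0..1} (\<lambda>s. F ((c \<circ> ?h) s) (?W s)) = integral {a..b} (\<lambda>t. F (c t) (V t))"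
    using ab by (intro C1_with_reparam[OF C1]; auto intro!: derivative_eq_intros)+
  then show ?thesis
    unfolding joins_def by (intro exI[of _ "c \<circ> ?h"] exI[of _ ?W]) auto
qed

text \<open>The smoothstep polynomial slows both curves down to velocity zero at the junction, so that
  their concatenation has no corner there.\<close>

lemma joins_trans:
  assumes "joins x y l" and "joins y z m"
  shows "joins x z (l + m)"
proof -
  obtain c1 V1 where 1: "C1_with {0..1} c1 V1" "c1 0 = x" "c1 1 = y"
    "l = integral {0..1} (\<lambda>t. F (c1 t) (V1 t))"
    using assms(1) unfolding joins_def by blast
  obtain c2 V2 where 2: "C1_with {0..1} c2 V2" "c2 0 = y" "c2 1 = z"
    "m = integral {0..1} (\<lambda>t. F (c2 t) (V2 t))"
    using assms(2) unfolding joins_def by blast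
  define h :: "real \<Rightarrow> real" where "h = (\<lambda>s. 3 * s^2 - 2 * s^3)"
  define h' :: "real \<Rightarrow> real" where "h' = (\<lambda>s. 6 * s * (1 - s))"
  \<comment> \<open>The shift by \<open>1\<close> lets the second curve run over
    \<open>{1..2}\<close>.\<close>
  define k where "k = (\<lambda>s. h (s - 1))"
  define k' where "k' = (\<lambda>s. h' (s - 1))"
  let ?c1 = "c1 \<circ> h" and ?c2 = "c2 \<circ> k"
  let ?W1 = "\<lambda>s \<phi>. h' s *\<^sub>R V1 (h s) \<phi>" and ?W2 = "\<lambda>s \<phi>. k' s *\<^sub>R V2 (k s) \<phi>"
  have W1: "C1_with {0..1} ?c1 ?W1" "integral {0..1} (\<lambda>s. F (?c1 s) (?W1 s)) = l"
    unfolding 1(4)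
    by (intro C1_with_reparam[OF 1(1)];
        auto simp: h_def h'_def algebra_simps power2_eq_square power3_eq_cube
          intro!: derivative_eq_intros continuous_intros mult_left_le_one_le)+
  have W2: "C1_with {1..2} ?c2 ?W2" "integral {1..2} (\<lambda>s. F (?c2 s) (?W2 s)) = m"
    unfolding 2(4)
    by (intro C1_with_reparam[OF 2(1)];
        auto simp: k_def k'_def h_def h'_def intro!: derivative_eq_intros continuous_intros;
        simp add: algebra_simps power2_eq_square power3_eq_cube)+
  define c where "c = (\<lambda>s. if s \<le> 1 then ?c1 s else ?c2 s)"
  define W where "W = (\<lambda>s. if s \<le> 1 then ?W1 s else ?W2 s)"
  have eq1: "c s = ?c1 s" "W s = ?W1 s" if "s \<in> {0..1}" for s
    using that by (auto simp: c_def W_def)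
  \<comment> \<open>The first branch of \<open>c\<close> and \<open>W\<close> covers
    \<open>s = 1\<close>. It agrees with the second there because \<open>c1 1 = c2 0\<close> and
    both fields are multiplied by \<open>h' 1 = h' 0 = 0\<close>.\<close>
  have eq2: "c s = ?c2 s" "W s = ?W2 s" if "s \<in> {1..2}" for s
    using that 1(3) 2(2) by (auto simp: c_def W_def h_def k_def h'_def k'_def)
  have "C1_with ({0..1} \<union> {1..2}) c W"
    by (intro C1_with_Un C1_with_cong[OF W1(1) eq1] C1_with_cong[OF W2(1) eq2]) auto
  moreover have "{0..1} \<union> {1..2} = {0..2::real}" by auto
  ultimately have C1: "C1_with {0..2} c W" by simp
  have "integral {0..2} (\<lambda>t. F (c t) (W t)) =
      integral {0..1} (\<lambda>t. F (c t) (W t)) + integral {1..2} (\<lambda>t. F (c t) (W t))"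
    using C1_with_has_integral[OF C1]
    by (intro Henstock_Kurzweil_Integration.integral_combine[symmetric]) auto
  also have "integral {0..1} (\<lambda>t. F (c t) (W t)) = l"
    unfolding W1(2)[symmetric] by (intro integral_cong) (simp only: eq1)
  also have "integral {1..2} (\<lambda>t. F (c t) (W t)) = m"
    unfolding W2(2)[symmetric] by (intro integral_cong) (simp only: eq2)
  finally have "joins (c 0) (c 2) (l + m)"
    using joinsI[OF C1] by simp
  then show ?thesis using 1 2 by (simp add: c_def h_def k_def)
qed

text \<open>The straight segment in coordinates stays in the ball by convexity and has constant
  coordinate velocity \<open>y - x\<close>; integrating the bound on \<open>local_F\<close>
  estimates its length.\<close>

lemma joins_chart_line:
  assumes \<phi>: "\<phi> \<in> A" and ball: "cball x0 e \<subseteq> chart_map \<phi> ` chart_dom \<phi>"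
    and bound: "\<And>x y. x \<in> cball x0 e \<Longrightarrow> local_F A F \<phi> (x, y) \<le> C * norm y"
    and x: "x \<in> cball x0 e" and y: "y \<in> cball x0 e"
  obtains l where "l \<le> C * norm (y - x)" "joins (chart_inv \<phi> x) (chart_inv \<phi> y) l"
proof -
  define g where "g = (\<lambda>t. x + t *\<^sub>R (y - x))"
  define c where "c = chart_inv \<phi> \<circ> g"
  define V where "V = (\<lambda>t. tvec_of A \<phi> (c t) (y - x))"
  have gball: "g t \<in> cball x0 e" if "t \<in> {0..1}" for t
  proof -
    have "g t = (1 - t) *\<^sub>R x + t *\<^sub>R y" by (simp add: g_def algebra_simps)
    then show ?thesis using convexD_alt[OF convex_cball x y] that by simp
  qed
  then have gU: "g t \<in> chart_map \<phi> ` chart_dom \<phi>" if "t \<in> {0..1}" for t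
    using ball that by blast
  have c: "c t \<in> chart_dom \<phi>" "chart_map \<phi> (c t) = g t" if "t \<in> {0..1}" for t
    using gU[OF that] \<phi> by (auto simp: c_def simp del: image_iff)
  have g: "(g has_vector_derivative (y - x)) (at t within S)" for t S
    unfolding g_def by (auto intro!: derivative_eq_intros)
  have contg: "continuous_on S g" for S
    unfolding g_def by (intro continuous_intros)
  have C1: "C1_with {0..1} c V"
    unfolding C1_with_def has_velocity_def
  proof (intro conjI ballI impI)
    fix t :: real assume t: "t \<in> {0..1}"
    show "continuous (at t within {0..1}) c"
      unfolding c_def
      by (rule continuous_within_compose[OF has_vector_derivative_continuous[OF g]
            continuous_at_imp_continuous_at_within[OF isCont_chart_inv[OF \<phi> gU[OF t]]]])
    show "V t \<in> tangent_space A (c t)"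
      unfolding V_def using \<phi> c[OF t] by (intro tvec_of_in)
  next
    fix t :: real and \<psi> assume t: "t \<in> {0..1}" and \<psi>: "\<psi> \<in> A" "c t \<in> chart_dom \<psi>"
    \<comment> \<open>Seen in another chart \<open>\<psi>\<close> the curve is
      \<open>transition \<phi> \<psi> \<circ> g\<close>, and the chain rule yields the entry of
      \<open>tvec_of\<close> at \<open>\<psi>\<close>.\<close>
    have "(transition \<phi> \<psi> has_derivative transition_deriv \<phi> \<psi> (c t)) (at (g t) within g ` {0..1})"
      using transition_has_derivative[OF \<phi> \<psi>(1), of "c t"] c[OF t] \<psi>(2)
      by (auto intro: has_derivative_at_withinI)
    then have "((transition \<phi> \<psi> \<circ> g) has_vector_derivative transition_deriv \<phi> \<psi> (c t) (y - x)) (at t within {0..1})"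
      by (rule vector_derivative_diff_chain_within[OF g])
    then show "((chart_map \<psi> \<circ> c) has_vector_derivative V t \<psi>) (at t within {0..1})"
      using \<psi> by (simp add: V_def tvec_of_def c_def transition_def o_assoc)
  next
    fix \<psi> assume \<psi>: "\<psi> \<in> A"
    let ?D = "{t \<in> {0..1}. c t \<in> chart_dom \<psi>}"
    \<comment> \<open>First-order smoothness of the transition map provides the continuous
      derivative.\<close>
    have "continuous_on (chart_map \<phi> ` (chart_dom \<phi> \<inter> chart_dom \<psi>))
        (\<lambda>z. frechet_derivative (transition \<phi> \<psi>) (at z) (y - x))"
      using transition_smooth[OF \<phi> \<psi>, of "Suc 0"] by simp
    moreover have "g ` ?D \<subseteq> chart_map \<phi> ` (chart_dom \<phi> \<inter> chart_dom \<psi>)"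
      using c by (auto intro!: image_eqI)
    ultimately have "continuous_on ?D (\<lambda>t. frechet_derivative (transition \<phi> \<psi>) (at (g t)) (y - x))"
      by (rule continuous_on_compose2[OF _ contg])
    then show "continuous_on ?D (\<lambda>t. V t \<psi>)"
      by (rule continuous_on_eq) (use \<psi> c in \<open>auto simp: V_def tvec_of_def transition_deriv_def\<close>)
  qed
  have "integral {0..1} (\<lambda>t. F (c t) (V t)) \<le> integral {0..1} (\<lambda>_::real. C * norm (y - x))"
  proof (rule integral_le)
    show "(\<lambda>t. F (c t) (V t)) integrable_on {0..1}"
      using C1_with_has_integral[OF C1] by blast
    fix t :: real assume "t \<in> {0..1}"
    then show "F (c t) (V t) \<le> C * norm (y - x)"
      using bound[OF gball, of t "y - x"] by (simp add: local_F_def V_def c_def)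
  qed auto
  moreover have "joins (chart_inv \<phi> x) (chart_inv \<phi> y) (integral {0..1} (\<lambda>t. F (c t) (V t)))"
    using joinsI[OF C1] by (simp add: c_def g_def)
  ultimately show ?thesis by (intro that) auto
qed

text \<open>Serves both reachability and the continuity of the distance. The points of
  \<open>N\<close> may be taken in either order, which matters because lengths are not
  symmetric.\<close>

lemma joins_nearby:
  obtains N \<phi> C where "\<phi> \<in> A" "open N" "x \<in> N" "N \<subseteq> chart_dom \<phi>"
    "\<And>y z. y \<in> N \<Longrightarrow> z \<in> N \<Longrightarrow> \<exists>l \<le> C * norm (chart_map \<phi> z - chart_map \<phi> y). joins y z l"
proof -
  obtain \<phi> where \<phi>: "\<phi> \<in> A" "x \<in> chart_dom \<phi>" by (rule chart_at)
  let ?x = "chart_map \<phi> x"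
  obtain e C where e: "e > 0" "cball ?x e \<subseteq> chart_map \<phi> ` chart_dom \<phi>"
    "\<And>x y. x \<in> cball ?x e \<Longrightarrow> local_F A F \<phi> (x, y) \<le> C * norm y"
    by (rule local_F_bound[OF \<phi>(1) imageI[OF \<phi>(2)]]) blast
  let ?N = "chart_dom \<phi> \<inter> chart_map \<phi> -` ball ?x e"
  show ?thesis
  proof (rule that[of \<phi> ?N C])
    show "open ?N"
      using continuous_chart_map[OF \<phi>(1)] open_chart_dom[OF \<phi>(1)] by (intro continuous_open_preimage) auto
    fix y z assume "y \<in> ?N" "z \<in> ?N"
    then have yz: "y \<in> chart_dom \<phi>" "z \<in> chart_dom \<phi>"
      "chart_map \<phi> y \<in> cball ?x e" "chart_map \<phi> z \<in> cball ?x e" by auto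
    show "\<exists>l \<le> C * norm (chart_map \<phi> z - chart_map \<phi> y). joins y z l"
      using joins_chart_line[OF \<phi>(1) e(2,3) yz(3,4)] chart_inv_map[OF \<phi>(1)] yz(1,2) by metis
  qed (use \<phi> e in auto)
qed

end

locale connected_finsler_manifold = finsler_manifold A F
  for A :: "('a::t2_space, 'n::finite) chart set" and F :: "('a, 'n) tfun" +
  assumes connected: "connected (UNIV :: 'a set)"
begin

section \<open>Reachability and the nonsymmetric distance\<close>

text \<open>The reachable set is nonempty and clopen in a connected space. The result ensures that
  the infimum defining \<open>d\<close> is over a nonempty set.\<close>

lemma joins_exists: "\<exists>l. joins x y l"
proof -
  let ?R = "{y. \<exists>l. joins x y l}"
  have N: "\<exists>N. open N \<and> y \<in> N \<and> (\<forall>z\<in>N. \<forall>w\<in>N. \<exists>l. joins z w l)" for y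
    using joins_nearby[of y] by metis
  have "open ?R"
  proof (subst open_subopen, rule ballI)
    fix y assume y: "y \<in> ?R"
    show "\<exists>T. open T \<and> y \<in> T \<and> T \<subseteq> ?R"
    proof -
      obtain l where l: "joins x y l" using y by blast
      obtain N where "open N" "y \<in> N" "\<forall>z\<in>N. \<forall>w\<in>N. \<exists>l. joins z w l" using N by blast
      then show ?thesis using joins_trans[OF l] by (intro exI[of _ N]) blast
    qed
  qed
  \<comment> \<open>If some point of \<open>N\<close> were reachable, a further curve from it to
    \<open>y\<close> would make \<open>y\<close> reachable.\<close>
  moreover have "open (- ?R)"
  proof (subst open_subopen, rule ballI)
    fix y assume y: "y \<in> - ?R"
    obtain N where "open N" "y \<in> N" "\<forall>z\<in>N. \<forall>w\<in>N. \<exists>l. joins z w l" using N by blast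
    then show "\<exists>T. open T \<and> y \<in> T \<and> T \<subseteq> - ?R"
      using y joins_trans by (intro exI[of _ N]) blast
  qed
  moreover have "x \<in> ?R" using N[of x] by blast
  ultimately have "?R = UNIV"
    using connected connected_clopen[of UNIV] by (auto simp: closed_def)
  then show ?thesis by blast
qed

abbreviation d :: "'a \<Rightarrow> 'a \<Rightarrow> real" where "d \<equiv> finsler_dist A F"

lemma bdd_below_joins: "bdd_below {l. joins x y l}"
  using joins_nonneg by (intro bdd_belowI[of _ 0]) simp

lemma dist_le: "joins x y l \<Longrightarrow> d x y \<le> l"
  unfolding finsler_dist_eq by (rule cInf_lower[OF _ bdd_below_joins]) simp

lemma dist_nonneg: "0 \<le> d x y"
  unfolding finsler_dist_eq using joins_exists joins_nonneg by (intro cInf_greatest) auto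

text \<open>The two infima are taken one after the other: first over curves from \<open>x\<close> to
  \<open>y\<close> with \<open>m\<close> fixed, then over \<open>m\<close>.\<close>

lemma dist_triangle: "d x z \<le> d x y + d y z"
proof -
  have "d x z - m \<le> d x y" if m: "joins y z m" for m
    unfolding finsler_dist_eq[of x y]
  proof (rule cInf_greatest)
    fix l assume "l \<in> {l. joins x y l}"
    then have "d x z \<le> l + m" using joins_trans[OF _ m] dist_le by blast
    then show "d x z - m \<le> l" by simp
  qed (use joins_exists in auto)
  then have "d x z - d x y \<le> m" if "joins y z m" for m
    using that by (simp add: algebra_simps)
  then have "d x z - d x y \<le> d y z"
    unfolding finsler_dist_eq[of y z] using joins_exists by (intro cInf_greatest) auto
  then show ?thesis by simp
qed

text \<open>Short coordinate segments issue from the limit point \<open>x\<close>. This is the order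
  of arguments needed to compare a point of \<open>\<zeta>\<close> with the approximating
  geodesics.\<close>

lemma dist_tendsto_0:
  assumes "(f \<longlongrightarrow> x) G"
  shows "((\<lambda>i. d x (f i)) \<longlongrightarrow> 0) G"
proof -
  obtain N \<phi> C where N: "\<phi> \<in> A" "open N" "x \<in> N" "N \<subseteq> chart_dom \<phi>"
    "\<And>y z. y \<in> N \<Longrightarrow> z \<in> N \<Longrightarrow> \<exists>l \<le> C * norm (chart_map \<phi> z - chart_map \<phi> y). joins y z l"
    using joins_nearby[of x] by metis
  show ?thesis
  proof (rule tendsto_sandwich[where f = "\<lambda>_. 0"])
    have "\<forall>\<^sub>F i in G. f i \<in> N"
      using assms N(2,3) by (rule topological_tendstoD)
    then show "\<forall>\<^sub>F i in G. d x (f i) \<le> C * norm (chart_map \<phi> (f i) - chart_map \<phi> x)"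
    proof eventually_elim
      case (elim i)
      then show ?case using N(5)[OF N(3)] dist_le by (meson order_trans)
    qed
    have "((\<lambda>i. chart_map \<phi> (f i)) \<longlongrightarrow> chart_map \<phi> x) G"
      using N(3,4) by (intro isCont_tendsto_compose[OF isCont_chart_map[OF N(1)] assms]) auto
    then show "((\<lambda>i. C * norm (chart_map \<phi> (f i) - chart_map \<phi> x)) \<longlongrightarrow> 0) G"
      by (auto intro!: tendsto_eq_intros)
  qed (auto simp: dist_nonneg)
qed

section \<open>Unit speed geodesics and distance\<close>

lemma dist_le_unit_speed:
  assumes C1: "C1_with {a..b} c V" and ab: "a < b" and unit: "\<And>t. t \<in> {a..b} \<Longrightarrow> F (c t) (V t) = 1"
  shows "d (c a) (c b) \<le> b - a"
proof -
  have "integral {a..b} (\<lambda>t. F (c t) (V t)) = integral {a..b} (\<lambda>_. 1)"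
    using unit by (intro integral_cong)
  then show ?thesis
    using dist_le[OF joinsI[OF C1 ab]] ab by simp
qed

text \<open>Along a geodesic the coordinate velocity \<open>x'\<close> is differentiable, hence
  continuous; uniqueness of derivatives identifies it with the field supplied by
  \<open>unit_speed\<close>.\<close>

lemma unit_speed_geodesic_C1:
  assumes geo: "geodesic A F {a..b} c" and unit: "unit_speed A F {a..b} c" and ab: "a < b"
  obtains V where "C1_with {a..b} c V" "\<And>t. t \<in> {a..b} \<Longrightarrow> F (c t) (V t) = 1"
proof -
  obtain V where V: "\<And>t. t \<in> {a..b} \<Longrightarrow> has_velocity A {a..b} c t (V t)"
    "\<And>t. t \<in> {a..b} \<Longrightarrow> F (c t) (V t) = 1"
    using unit unfolding unit_speed_def by metis
  have "C1_with {a..b} c V"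
    unfolding C1_with_def
  proof (intro conjI ballI)
    fix \<phi> assume \<phi>: "\<phi> \<in> A"
    let ?D = "{t \<in> {a..b}. c t \<in> chart_dom \<phi>}"
    obtain x' x'' where x: "\<And>t. t \<in> ?D \<Longrightarrow> ((chart_map \<phi> \<circ> c) has_vector_derivative x' t) (at t within {a..b})"
      "\<And>t. t \<in> ?D \<Longrightarrow> (x' has_vector_derivative x'' t) (at t within {a..b})"
      using geo \<phi> unfolding geodesic_def by blast
    have "continuous_on ?D x'"
      unfolding continuous_on_eq_continuous_within
      by (intro ballI continuous_within_subset[OF has_vector_derivative_continuous[OF x(2)]]) auto
    moreover have "x' t = V t \<phi>" if "t \<in> ?D" for t
      using x(1)[OF that] V(1)[of t] that \<phi> at_within_interval_neq_bot[OF ab, of t]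
      unfolding has_velocity_def by (intro vector_derivative_unique_within) auto
    ultimately show "continuous_on ?D (\<lambda>t. V t \<phi>)"
      by (rule continuous_on_eq)
  qed (rule V(1))
  then show ?thesis using V(2) that by blast
qed

text \<open>The rest of the geodesic after time \<open>t\<close> is a curve to \<open>y\<close> of
  length \<open>d x y - t\<close>; strictness of \<open>t < d x y\<close> keeps its parameter
  interval nondegenerate.\<close>

lemma dist_minimal_geodesic:
  assumes min: "unit_speed_minimal_geodesic A F x y c" and t: "0 \<le> t" "t < d x y"
  shows "d (c t) y \<le> d x y - t"
proof -
  obtain V where V: "C1_with {0..d x y} c V" "\<And>t. t \<in> {0..d x y} \<Longrightarrow> F (c t) (V t) = 1"
    using min t unit_speed_geodesic_C1 unfolding unit_speed_minimal_geodesic_def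
    by (metis order_le_less_trans)
  have "d (c t) (c (d x y)) \<le> d x y - t"
    using V t by (intro dist_le_unit_speed[of _ _ _ V] C1_with_subset[OF V(1)]) auto
  then show ?thesis
    using min unfolding unit_speed_minimal_geodesic_def by simp
qed

section \<open>Busemann functions\<close>

lemma ray_dist: "forward_ray A F \<gamma> \<Longrightarrow> 0 \<le> s \<Longrightarrow> s < t \<Longrightarrow> d (\<gamma> s) (\<gamma> t) = t - s"
  unfolding forward_ray_def by blast

text \<open>\<open>Lim\<close> carries information only once a limit exists. Here the limit is the
  infimum, because the triangle inequality through \<open>\<gamma> s\<close> gives monotonicity and
  the one from \<open>\<gamma> 0\<close> gives a lower bound.\<close>

lemma busemann_tendsto:
  assumes ray: "forward_ray A F \<gamma>"
  shows "((\<lambda>t. d x (\<gamma> t) - t) \<longlongrightarrow> busemann A F \<gamma> x) at_top"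
proof -
  let ?f = "\<lambda>t. d x (\<gamma> t) - t"
  let ?L = "Inf (?f ` {0<..})"
  \<comment> \<open>Positive times are used because \<open>ray_dist\<close> compares strictly
    ordered parameters, here \<open>0 < t\<close>.\<close>
  have lower: "- d (\<gamma> 0) x \<le> ?f t" if "t > 0" for t
    using ray_dist[OF ray, of 0 t] dist_triangle[of "\<gamma> 0" "\<gamma> t" x] that by simp
  have bdd: "bdd_below (?f ` {0<..})" using lower by (intro bdd_belowI2) auto
  have mono: "?f t \<le> ?f s" if "0 < s" "s \<le> t" for s t
    using ray_dist[OF ray, of s t] dist_triangle[of x "\<gamma> t" "\<gamma> s"] that by (cases "s = t") auto
  have "(?f \<longlongrightarrow> ?L) at_top"
  proof (rule order_tendstoI)
    fix a assume "a < ?L"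
    then have "a < ?f t" if "t > 0" for t
      using cInf_lower[OF _ bdd, of "?f t"] that by force
    then show "\<forall>\<^sub>F t in at_top. a < ?f t"
      by (intro eventually_mono[OF eventually_gt_at_top[of 0]])
  next
    fix a assume "?L < a"
    then obtain s where s: "s > 0" "?f s < a"
      using bdd by (subst (asm) cInf_less_iff) auto
    then have "?f t < a" if "t \<ge> s" for t using mono[of s t] that by simp
    then show "\<forall>\<^sub>F t in at_top. ?f t < a"
      by (intro eventually_mono[OF eventually_ge_at_top[of s]])
  qed
  then show ?thesis unfolding busemann_def by (simp add: tendsto_Lim)
qed

lemma busemann_le_add:
  assumes "forward_ray A F \<gamma>"
  shows "busemann A F \<gamma> x \<le> d x y + busemann A F \<gamma> y"
proof (rule tendsto_le)
  show "((\<lambda>t. d x y + (d y (\<gamma> t) - t)) \<longlongrightarrow> d x y + busemann A F \<gamma> y) at_top"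
    by (intro tendsto_intros busemann_tendsto assms)
  show "\<forall>\<^sub>F t in at_top. d x (\<gamma> t) - t \<le> d x y + (d y (\<gamma> t) - t)"
    using dist_triangle by (intro always_eventually) (simp add: algebra_simps)
qed (auto intro: busemann_tendsto assms)

lemma busemann_ray:
  assumes ray: "forward_ray A F \<gamma>" and t: "0 \<le> t"
  shows "busemann A F \<gamma> (\<gamma> t) = - t"
proof -
  have "\<forall>\<^sub>F s in at_top. d (\<gamma> t) (\<gamma> s) - s = - t"
    using eventually_gt_at_top[of t] by eventually_elim (simp add: ray_dist[OF ray t])
  then have "((\<lambda>s. d (\<gamma> t) (\<gamma> s) - s) \<longlongrightarrow> - t) at_top"
    by (rule tendsto_eventually)
  then show ?thesis
    using busemann_tendsto[OF ray] tendsto_unique trivial_limit_at_top_linorder by blast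
qed

text \<open>Guarantees that each fixed time eventually lies in the parameter intervals of the
  minimal geodesics ending on the ray.\<close>

lemma dist_ray_at_top:
  assumes ray: "forward_ray A F \<gamma>" shows "filterlim (\<lambda>t. d x (\<gamma> t)) at_top at_top"
proof (rule filterlim_at_top_mono)
  show "\<forall>\<^sub>F t in at_top. - d (\<gamma> 0) x + t \<le> d x (\<gamma> t)"
    using eventually_gt_at_top[of 0]
  proof eventually_elim
    case (elim t)
    then show ?case using ray_dist[OF ray, of 0 t] dist_triangle[of "\<gamma> 0" "\<gamma> t" x] by simp
  qed
  show "filterlim (\<lambda>t. - d (\<gamma> 0) x + t) at_top at_top"
    by (rule filterlim_tendsto_add_at_top[OF tendsto_const filterlim_ident])
qed

lemma busemann_asymptotic:
  assumes \<eta>: "forward_ray A F \<eta>" and \<zeta>: "forward_ray A F \<zeta>" and asym: "asymptotic A F \<zeta> \<eta>"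
    and t: "0 \<le> t"
  shows "busemann A F \<eta> (\<zeta> t) = busemann A F \<eta> (\<zeta> 0) - t"
proof (rule antisym)
  obtain T \<sigma> where T: "filterlim T at_top sequentially"
    and \<sigma>: "\<And>i. unit_speed_minimal_geodesic A F (\<zeta> 0) (\<eta> (T i)) (\<sigma> i)"
    and lim: "(\<lambda>i. \<sigma> i t) \<longlonglongrightarrow> \<zeta> t"
    using asym t unfolding asymptotic_def by blast
  \<comment> \<open>The limit along \<open>at_top\<close> exists, so it may be computed along the
    sequence \<open>T\<close>.\<close>
  have B: "(\<lambda>i. d x (\<eta> (T i)) - T i) \<longlonglongrightarrow> busemann A F \<eta> x" for x
    by (rule filterlim_compose[OF busemann_tendsto[OF \<eta>] T])
  show "busemann A F \<eta> (\<zeta> t) \<le> busemann A F \<eta> (\<zeta> 0) - t"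
  proof (rule tendsto_le)
    show "(\<lambda>i. d (\<zeta> t) (\<eta> (T i)) - T i) \<longlonglongrightarrow> busemann A F \<eta> (\<zeta> t)" by (rule B)
    show "(\<lambda>i. d (\<zeta> t) (\<sigma> i t) + (d (\<zeta> 0) (\<eta> (T i)) - T i) - t) \<longlonglongrightarrow> busemann A F \<eta> (\<zeta> 0) - t"
      using tendsto_diff[OF tendsto_add[OF dist_tendsto_0[OF lim] B[of "\<zeta> 0"]] tendsto_const[of t]] by simp
    \<comment> \<open>For these \<open>i\<close> the point \<open>\<sigma> i t\<close> precedes the
      end point \<open>\<eta> (T i)\<close> on the minimal geodesic.\<close>
    have "\<forall>\<^sub>F i in sequentially. t < d (\<zeta> 0) (\<eta> (T i))"
      using filterlim_compose[OF dist_ray_at_top[OF \<eta>] T] by (simp add: filterlim_at_top_dense)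
    then show "\<forall>\<^sub>F i in sequentially. d (\<zeta> t) (\<eta> (T i)) - T i \<le>
        d (\<zeta> t) (\<sigma> i t) + (d (\<zeta> 0) (\<eta> (T i)) - T i) - t"
    proof eventually_elim
      case (elim i)
      then show ?case
        using dist_minimal_geodesic[OF \<sigma> t elim] dist_triangle[of "\<zeta> t" "\<eta> (T i)" "\<sigma> i t"] by simp
    qed
  qed simp
next
  \<comment> \<open>At \<open>t = 0\<close> the inequality to be shown is trivial, while
    \<open>ray_dist\<close> requires \<open>0 < t\<close>.\<close>
  have "d (\<zeta> 0) (\<zeta> t) = t" if "t \<noteq> 0"
    using ray_dist[OF \<zeta>, of 0 t] t that by simp
  then show "busemann A F \<eta> (\<zeta> 0) - t \<le> busemann A F \<eta> (\<zeta> t)"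
    using busemann_le_add[OF \<eta>, of "\<zeta> 0" "\<zeta> t"] by (cases "t = 0") auto
qed

text \<open>The term \<open>- t\<close> in the value of the Busemann function of
  \<open>\<eta>\<close> at \<open>\<zeta> t\<close> completes \<open>d x (\<zeta> t)\<close> to the
  expression whose limit is the Busemann function of \<open>\<zeta>\<close>.\<close>

lemma busemann_diff_le:
  assumes \<eta>: "forward_ray A F \<eta>" and \<zeta>: "forward_ray A F \<zeta>" and asym: "asymptotic A F \<zeta> \<eta>"
  shows "busemann A F \<eta> x - busemann A F \<zeta> x \<le> busemann A F \<eta> (\<zeta> 0)"
proof -
  have "busemann A F \<eta> x \<le> busemann A F \<eta> (\<zeta> 0) + busemann A F \<zeta> x"
  proof (rule tendsto_lowerbound)
    show "((\<lambda>t. busemann A F \<eta> (\<zeta> 0) + (d x (\<zeta> t) - t)) \<longlongrightarrow> busemann A F \<eta> (\<zeta> 0) + busemann A F \<zeta> x) at_top"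
      by (intro tendsto_intros busemann_tendsto \<zeta>)
    show "\<forall>\<^sub>F t in at_top. busemann A F \<eta> x \<le> busemann A F \<eta> (\<zeta> 0) + (d x (\<zeta> t) - t)"
      using eventually_ge_at_top[of 0]
    proof eventually_elim
      case (elim t)
      then show ?case
        using busemann_le_add[OF \<eta>, of x "\<zeta> t"] busemann_asymptotic[OF \<eta> \<zeta> asym, of t] by simp
    qed
  qed simp
  then show ?thesis by simp
qed

end

theorem proposition3p11:
  fixes A :: "('a::{t2_space, second_countable_topology}, 'n::finite) chart set"
    and F :: "('a, 'n) tfun"
    and \<eta> \<zeta> :: "real \<Rightarrow> 'a" and p :: 'a
  assumes "connected (UNIV :: 'a set)"
    and "CARD('n) > 1"
    and "smooth_atlas A"
    and "orientable A"
    and "finsler_structure A F"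
    and "forward_complete A F"
    and "forward_ray A F \<eta>"
    and "forward_ray A F \<zeta>"
    and "p = \<zeta> 0"
    and "asymptotic A F \<zeta> \<eta>"
  shows "(\<forall>t\<ge>0. busemann A F \<eta> (\<zeta> t) = busemann A F \<eta> p + busemann A F \<zeta> (\<zeta> t) \<and>
                busemann A F \<eta> p + busemann A F \<zeta> (\<zeta> t) = busemann A F \<eta> p - t) \<and>
         (\<forall>x. busemann A F \<eta> x - busemann A F \<zeta> x \<le> busemann A F \<eta> p)"
proof -
  interpret connected_finsler_manifold A F
    by (intro connected_finsler_manifold.intro finsler_manifold.intro
        connected_finsler_manifold_axioms.intro assms)
  show ?thesis
    unfolding assms(9)
  proof (intro conjI allI impI)
    fix t :: real assume t: "0 \<le> t"
    show "busemann A F \<eta> (\<zeta> t) = busemann A F \<eta> (\<zeta> 0) + busemann A F \<zeta> (\<zeta> t)"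
      unfolding busemann_asymptotic[OF assms(7,8,10) t] busemann_ray[OF assms(8) t] by simp
    show "busemann A F \<eta> (\<zeta> 0) + busemann A F \<zeta> (\<zeta> t) = busemann A F \<eta> (\<zeta> 0) - t"
      unfolding busemann_ray[OF assms(8) t] by simp
  qed (rule busemann_diff_le[OF assms(7,8,10)])
qed

end
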